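(* Let $G$ be a finite group and $N\unlhd G$. Let $g_i\in G$ ($i=1,\ldots,k(G/N)$) be such that the cosets $g_iN$ are representatives of the conjugacy classes of $G/N$. Then \[k(G)\ \leq\ \sum_{i=1}^{k(G/N)}|C_{\mathrm{cl}(N)}(g_i)|.\]
   Context: For a finite group $X$, $k(X)$ denotes the number of conjugacy classes of $X$ and $\mathrm{cl}(X)$ the set of conjugacy classes of $X$. If $N\unlhd G$ and $g\in G$, then $C_{\mathrm{cl}(N)}(g)$ is the set of those $N$-conjugacy classes of $N$ which are mapped to themselves (as sets) by conjugation with $g$. *)

theory Defs
  imports "HOL-Algebra.Group_Action"
begin

definition conj_act :: "('a, 'b) monoid_scheme \<Rightarrow> 'a \<Rightarrow> 'a \<Rightarrow> 'a"
  where "conj_act X = (\<lambda>g. \<lambda>h \<in> carrier X. g \<otimes>\<^bsub>X\<^esub> h \<otimes>\<^bsub>X\<^esub> inv\<^bsub>X\<^esub> g)"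

definition conj_class :: "('a, 'b) monoid_scheme \<Rightarrow> 'a \<Rightarrow> 'a set"
  where "conj_class X x = orbit X (conj_act X) x"

definition conj_classes :: "('a, 'b) monoid_scheme \<Rightarrow> 'a set set"
  where "conj_classes X = orbits X (carrier X) (conj_act X)"

definition class_number :: "('a, 'b) monoid_scheme \<Rightarrow> nat"
  where "class_number X = card (conj_classes X)"

text \<open>The group structure on a subgroup \<open>N\<close> of \<open>G\<close> is \<open>G\<lparr>carrier := N\<rparr>\<close>, so the classes
  below are \<open>N\<close>-classes of elements of \<open>N\<close>; the conjugating element \<open>g\<close> ranges over \<open>G\<close>.\<close>

definition fixed_classes :: "('a, 'b) monoid_scheme \<Rightarrow> 'a set \<Rightarrow> 'a \<Rightarrow> 'a set set"
  where "fixed_classes G N g =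
    invariants (conj_classes (G\<lparr>carrier := N\<rparr>))
      (\<lambda>x K. x <#\<^bsub>G\<^esub> K #>\<^bsub>G\<^esub> inv\<^bsub>G\<^esub> x) g"

end

theory Submission
  imports Defs
begin

text \<open>Every \<open>G\<close>-class lying over the class of \<open>gN\<close> contains an \<open>N\<close>-orbit (under conjugation) on the
  coset \<open>gN\<close>, so it suffices that \<open>gN\<close> has exactly as many \<open>N\<close>-orbits as there are \<open>g\<close>-invariant
  \<open>N\<close>-classes in \<open>N\<close>. To see this, count the commuting pairs \<open>(x, n)\<close> with \<open>x \<in> gN\<close> and
  \<open>n \<in> N\<close> in two ways. For fixed \<open>x\<close> one gets \<open>|C_N(x)|\<close>. For fixed \<open>n\<close> one gets a coset of
  \<open>C_N(n)\<close> if the class of \<open>n\<close> is \<open>g\<close>-invariant, and nothing otherwise. In both cases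
  each \<open>N\<close>-orbit contributes \<open>|N|\<close> by the orbit-stabilizer theorem.\<close>

text \<open>By orbit-stabilizer, each orbit contributes \<open>order G\<close>. The set
  \<open>P\<close> is left arbitrary because the lemma serves twice: for the orbits on one coset and
  for the invariant classes inside the normal subgroup.\<close>

lemma (in group_action) sum_card_stabilizer_Union_orbits:
  assumes "finite (carrier G)" "finite E" "P \<subseteq> orbits G E \<phi>"
  shows "(\<Sum>x\<in>\<Union>P. card (stabilizer G \<phi> x)) = card P * order G"
proof -
  have "(\<Sum>x\<in>\<Union>P. card (stabilizer G \<phi> x)) = (\<Sum>K\<in>P. \<Sum>x\<in>K. card (stabilizer G \<phi> x))"
  proof (subst sum.Union_disjoint)
    show "\<forall>A\<in>P. finite A"
      using assms orbits_coverture by (metis Sup_upper finite_subset subset_iff)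
    show "\<forall>A\<in>P. \<forall>B\<in>P. A \<noteq> B \<longrightarrow> A \<inter> B = {}"
      using assms(3) disjoint_union by blast
  qed simp
  also have "\<dots> = (\<Sum>K\<in>P. order G)"
    using assms card_stablizer_sum by (intro sum.cong) auto
  finally show ?thesis by simp
qed

context normal
begin

lemma conj_act_normal_subgroup: "group_action (G\<lparr>carrier := H\<rparr>) (carrier G) (conj_act G)"
  unfolding conj_act_def
  using group_action.induced_action[OF action_by_conjugation subgroup_axioms] .

lemma orbit_conj_act:
  assumes "x \<in> carrier G"
  shows "orbit (G\<lparr>carrier := H\<rparr>) (conj_act G) x = (\<lambda>n. n \<otimes> x \<otimes> inv n) ` H"
  using assms by (auto simp: orbit_def conj_act_def)

lemma stabilizer_conj_act:
  assumes "x \<in> carrier G"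
  shows "stabilizer (G\<lparr>carrier := H\<rparr>) (conj_act G) x = {n \<in> H. x \<otimes> n = n \<otimes> x}"
proof -
  have "n \<otimes> x \<otimes> inv n = x \<longleftrightarrow> x \<otimes> n = n \<otimes> x" if "n \<in> H" for n
    using that assms by (metis inv_solve_right' m_closed mem_carrier)
  then show ?thesis using assms by (auto simp: stabilizer_def conj_act_def)
qed

lemma conj_classes_normal_subgroup:
  "conj_classes (G\<lparr>carrier := H\<rparr>) = (\<lambda>x. (\<lambda>n. n \<otimes> x \<otimes> inv n) ` H) ` H"
proof -
  have inv_eq: "inv\<^bsub>G\<lparr>carrier := H\<rparr>\<^esub> n = inv n" if "n \<in> H" for n
    using that m_inv_consistent subgroup_axioms by blast
  have "orbit (G\<lparr>carrier := H\<rparr>) (conj_act (G\<lparr>carrier := H\<rparr>)) x = (\<lambda>n. n \<otimes> x \<otimes> inv n) ` H"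
    if "x \<in> H" for x
    using that by (auto simp: orbit_def conj_act_def inv_eq image_iff) (metis inv_eq)+
  then show ?thesis
    unfolding conj_classes_def orbits_def by auto
qed

text \<open>This places the classes of \<open>H\<close> and the orbits on a coset inside one and the
  same action, that of \<open>H\<close> on \<open>carrier G\<close>, so that both counts refer to
  the same stabilizers.\<close>

lemma conj_classes_subset_orbits:
  "conj_classes (G\<lparr>carrier := H\<rparr>) \<subseteq> orbits (G\<lparr>carrier := H\<rparr>) (carrier G) (conj_act G)"
  unfolding conj_classes_normal_subgroup orbits_def
  using orbit_conj_act mem_carrier by blast

lemma l_coset_eq_r_coset_rep:
  assumes "g \<in> carrier G" "x \<in> g <# H"
  shows "g <# H = H #> x"
  using assms coset_eq repr_independence subgroup_axioms by metis

text \<open>Conjugating by \<open>m\<close> and then by \<open>g\<close> is conjugating by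
  \<open>g \<otimes> m\<close>. Invariance of the class of \<open>n\<close> thus becomes a statement
  about conjugating \<open>n\<close> by the elements of the coset.\<close>

lemma conjugate_class_eq:
  assumes "g \<in> carrier G" "n \<in> carrier G"
  shows "g <# ((\<lambda>m. m \<otimes> n \<otimes> inv m) ` H) #> inv g = (\<lambda>z. z \<otimes> n \<otimes> inv z) ` (g <# H)"
proof -
  have "g \<otimes> (m \<otimes> n \<otimes> inv m) \<otimes> inv g = (g \<otimes> m) \<otimes> n \<otimes> inv (g \<otimes> m)" if "m \<in> H" for m
    using that assms mem_carrier by (simp add: inv_mult_group m_assoc)
  then show ?thesis
    unfolding l_coset_def r_coset_def by (auto simp: image_iff)
qed

text \<open>Conjugating \<open>n\<close> by all of \<open>g <# H\<close> sweeps out the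
  \<open>g\<close>-image of its class. This image is the class itself exactly when it contains
  \<open>n\<close>, that is, when some element of the coset centralizes \<open>n\<close>.\<close>

lemma Union_fixed_classes:
  assumes g: "g \<in> carrier G"
  shows "\<Union>(fixed_classes G H g) = {n \<in> H. \<exists>x \<in> g <# H. x \<otimes> n = n \<otimes> x}"
proof (intro equalityI subsetI)
  let ?K = "\<lambda>n. (\<lambda>m. m \<otimes> n \<otimes> inv m) ` H"
  fix n assume "n \<in> \<Union>(fixed_classes G H g)"
  then obtain K where K: "K \<in> conj_classes (G\<lparr>carrier := H\<rparr>)" "g <# K #> inv g = K" "n \<in> K"
    by (auto simp: fixed_classes_def invariants_def)
  interpret A: group_action "G\<lparr>carrier := H\<rparr>" "carrier G" "conj_act G"
    by (rule conj_act_normal_subgroup)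
  obtain n0 where n0: "n0 \<in> H" "K = ?K n0"
    using K(1) by (auto simp: conj_classes_normal_subgroup)
  have n: "n \<in> H" using K(3) n0 by auto
  have "n \<in> orbit (G\<lparr>carrier := H\<rparr>) (conj_act G) n"
    using n by (simp add: A.orbit_refl)
  then have nK: "n \<in> ?K n" using n orbit_conj_act by auto
  have "?K n \<in> orbits (G\<lparr>carrier := H\<rparr>) (carrier G) (conj_act G)"
    "K \<in> orbits (G\<lparr>carrier := H\<rparr>) (carrier G) (conj_act G)"
    using K(1) n conj_classes_subset_orbits by (auto simp: conj_classes_normal_subgroup)
  \<comment> \<open>The class was generated by \<open>n0\<close>; since distinct orbits are
    disjoint, it can be rebased at its element \<open>n\<close>.\<close>
  then have KK: "K = ?K n" using A.disjoint_union nK K(3) by blast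
  then have "n \<in> (\<lambda>z. z \<otimes> n \<otimes> inv z) ` (g <# H)"
    using K conjugate_class_eq[of g n] g n by simp
  then obtain z where z: "z \<in> g <# H" "n = z \<otimes> n \<otimes> inv z" by auto
  have "z \<in> carrier G" using z(1) g l_coset_subset_G subset by blast
  then have "z \<otimes> n = n \<otimes> z" using z(2) n
    by (metis inv_solve_right' m_closed mem_carrier)
  then show "n \<in> {n \<in> H. \<exists>x \<in> g <# H. x \<otimes> n = n \<otimes> x}" using n z by auto
next
  let ?K = "\<lambda>n. (\<lambda>m. m \<otimes> n \<otimes> inv m) ` H"
  fix n assume "n \<in> {n \<in> H. \<exists>x \<in> g <# H. x \<otimes> n = n \<otimes> x}"
  then obtain x where n: "n \<in> H" and x: "x \<in> g <# H" "x \<otimes> n = n \<otimes> x" by auto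
  have nc: "n \<in> carrier G" and xc: "x \<in> carrier G"
    using n x(1) g l_coset_subset_G subset by blast+
  have xn: "x \<otimes> n \<otimes> inv x = n" using x(2) nc xc by (simp add: m_assoc)
  \<comment> \<open>As \<open>x\<close> centralizes \<open>n\<close>, it drops out of the
    conjugation. Writing the coset as \<open>H #> x\<close> then shows that it sweeps out just the
    class of \<open>n\<close>.\<close>
  have "(m \<otimes> x) \<otimes> n \<otimes> inv (m \<otimes> x) = m \<otimes> n \<otimes> inv m" if m: "m \<in> H" for m
  proof -
    have "(m \<otimes> x) \<otimes> n \<otimes> inv (m \<otimes> x) = m \<otimes> (x \<otimes> n \<otimes> inv x) \<otimes> inv m"
      using m nc xc mem_carrier by (simp add: inv_mult_group m_assoc)
    then show ?thesis using xn by simp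
  qed
  then have "(\<lambda>z. z \<otimes> n \<otimes> inv z) ` (H #> x) = ?K n"
    unfolding r_coset_def by (auto simp: image_iff)
  then have "g <# ?K n #> inv g = ?K n"
    using conjugate_class_eq[OF g nc] l_coset_eq_r_coset_rep[OF g x(1)] by simp
  then have "?K n \<in> fixed_classes G H g"
    using n by (auto simp: fixed_classes_def invariants_def conj_classes_normal_subgroup)
  moreover have "n \<in> ?K n" using nc by (auto intro!: image_eqI[of _ _ \<one>])
  ultimately show "n \<in> \<Union>(fixed_classes G H g)" by blast
qed

text \<open>Since \<open>x\<close> commutes with \<open>n\<close>, the product
  \<open>x \<otimes> m\<close> does so iff \<open>m\<close> does. Hence left multiplication by
  \<open>x\<close> maps the centralizer of \<open>n\<close> in \<open>H\<close> bijectively onto the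
  commuting elements of the coset.\<close>

lemma card_commuting_in_coset:
  assumes g: "g \<in> carrier G" and n: "n \<in> H" and x: "x \<in> g <# H" "x \<otimes> n = n \<otimes> x"
  shows "card {y \<in> g <# H. y \<otimes> n = n \<otimes> y} = card {m \<in> H. n \<otimes> m = m \<otimes> n}"
proof -
  have nc: "n \<in> carrier G" and xc: "x \<in> carrier G"
    using n x(1) g l_coset_subset_G subset by blast+
  have gH: "g <# H = x <# H"
    using l_coset_eq_r_coset_rep[OF g x(1)] xc coset_eq by simp
  have comm: "(x \<otimes> m) \<otimes> n = n \<otimes> (x \<otimes> m) \<longleftrightarrow> n \<otimes> m = m \<otimes> n" if "m \<in> H" for m
  proof -
    have mc: "m \<in> carrier G" using that by simp
    have "n \<otimes> (x \<otimes> m) = x \<otimes> (n \<otimes> m)" using mc nc xc x(2) by (metis m_assoc)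
    then show ?thesis using mc nc xc by (auto simp: m_assoc)
  qed
  have "{y \<in> g <# H. y \<otimes> n = n \<otimes> y} = (\<lambda>m. x \<otimes> m) ` {m \<in> H. n \<otimes> m = m \<otimes> n}"
    unfolding gH using comm by (auto simp: l_coset_def)
  moreover have "inj_on (\<lambda>m. x \<otimes> m) {m \<in> H. n \<otimes> m = m \<otimes> n}"
    using xc by (auto simp: inj_on_def)
  ultimately show ?thesis by (simp add: card_image)
qed

text \<open>Conjugating \<open>x\<close> by \<open>m\<close> multiplies it on the left by the
  commutator of \<open>m\<close> and \<open>x\<close>, which lies in \<open>H\<close> by normality.
  Thus the coset is a union of orbits.\<close>

lemma orbit_subset_coset:
  assumes g: "g \<in> carrier G" and x: "x \<in> g <# H"
  shows "orbit (G\<lparr>carrier := H\<rparr>) (conj_act G) x \<subseteq> g <# H"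
proof -
  have xc: "x \<in> carrier G"
    using x g l_coset_subset_G subset by blast
  have gx: "g <# H = H #> x" by (rule l_coset_eq_r_coset_rep[OF g x])
  have "m \<otimes> x \<otimes> inv m \<in> H #> x" if m: "m \<in> H" for m
  proof -
    have mc: "m \<in> carrier G" using m by simp
    have "m \<otimes> x \<otimes> inv m = (m \<otimes> (x \<otimes> inv m \<otimes> inv x)) \<otimes> x"
      using xc mc by (simp add: m_assoc)
    moreover have "m \<otimes> (x \<otimes> inv m \<otimes> inv x) \<in> H"
      using m xc inv_op_closed2 by simp
    ultimately show ?thesis unfolding r_coset_def by blast
  qed
  then show ?thesis using gx orbit_conj_act[OF xc] by auto
qed

lemma card_orbits_coset_eq_card_fixed_classes:
  assumes fin: "finite (carrier G)" and g: "g \<in> carrier G"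
  shows "card (orbits (G\<lparr>carrier := H\<rparr>) (g <# H) (conj_act G)) = card (fixed_classes G H g)"
proof -
  let ?N = "G\<lparr>carrier := H\<rparr>" and ?C = "\<lambda>x. {n \<in> H. x \<otimes> n = n \<otimes> x}"
  interpret A: group_action ?N "carrier G" "conj_act G"
    by (rule conj_act_normal_subgroup)
  have finH: "finite H" using fin subset finite_subset by blast
  have sub: "g <# H \<subseteq> carrier G" using g l_coset_subset_G subset by blast
  have fing: "finite (g <# H)" using sub fin finite_subset by blast
  have st: "card (stabilizer ?N (conj_act G) x) = card (?C x)" if "x \<in> carrier G" for x
    using stabilizer_conj_act[OF that] by simp
  have "orbits ?N (g <# H) (conj_act G) \<subseteq> orbits ?N (carrier G) (conj_act G)"
    using sub by (auto simp: orbits_def)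
  moreover have "\<Union>(orbits ?N (g <# H) (conj_act G)) = g <# H"
    using orbit_subset_coset[OF g] A.orbit_refl sub by (auto simp: orbits_def) blast+
  ultimately have "card (orbits ?N (g <# H) (conj_act G)) * order ?N = (\<Sum>x\<in>g <# H. card (?C x))"
    using A.sum_card_stabilizer_Union_orbits[of "orbits ?N (g <# H) (conj_act G)"] fin finH st sub
    by (simp add: subset_iff cong: sum.cong)
  also have "\<dots> = (\<Sum>x\<in>g <# H. \<Sum>n\<in>H. if x \<otimes> n = n \<otimes> x then 1 else 0)"
    using finH by (intro sum.cong refl card_as_sums) auto
  also have "\<dots> = (\<Sum>n\<in>H. \<Sum>x\<in>g <# H. if x \<otimes> n = n \<otimes> x then 1 else 0)"
    by (rule sum.swap)
  also have "\<dots> = (\<Sum>n\<in>H. card {x \<in> g <# H. x \<otimes> n = n \<otimes> x})"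
    using fing by (intro sum.cong refl card_as_sums[symmetric]) auto
  \<comment> \<open>The discarded terms vanish: outside the invariant classes nothing in the coset
    commutes with \<open>n\<close>.\<close>
  also have "\<dots> = (\<Sum>n\<in>\<Union>(fixed_classes G H g). card {x \<in> g <# H. x \<otimes> n = n \<otimes> x})"
    using finH by (intro sum.mono_neutral_right) (auto simp: Union_fixed_classes[OF g] card_eq_0_iff)
  also have "\<dots> = (\<Sum>n\<in>\<Union>(fixed_classes G H g). card (stabilizer ?N (conj_act G) n))"
    by (intro sum.cong refl) (auto simp: Union_fixed_classes[OF g] st card_commuting_in_coset[OF g])
  also have "\<dots> = card (fixed_classes G H g) * order ?N"
    using conj_classes_subset_orbits fin finH
    by (intro A.sum_card_stabilizer_Union_orbits) (auto simp: fixed_classes_def invariants_def)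
  \<comment> \<open>The common factor \<open>order ?N\<close> cancels, being positive because
    \<open>H\<close> is finite and contains \<open>\<one>\<close>.\<close>
  finally show ?thesis
    using finH subgroup_axioms subgroup.one_closed by (fastforce simp: order_def card_eq_0_iff)
qed

text \<open>Conjugacy in the quotient determines \<open>x\<close> only up to a factor from
  \<open>H\<close>: it equals \<open>h \<otimes> (y \<otimes> g \<otimes> inv y)\<close>.
  Conjugating back by \<open>inv y\<close> turns \<open>h\<close> into another element of
  \<open>H\<close>, by normality, and lands in the coset of \<open>g\<close>.\<close>

lemma conjugate_in_coset:
  assumes g: "g \<in> carrier G" and x: "x \<in> carrier G"
    and cl: "x <# H \<in> conj_class (G Mod H) (g <# H)"
  obtains y where "y \<in> carrier G" "y \<otimes> x \<otimes> inv y \<in> g <# H"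
proof -
  have gm: "g <# H \<in> carrier (G Mod H)"
    using g coset_eq by (auto simp: FactGroup_def RCOSETS_def)
  obtain Y where Y: "Y \<in> carrier (G Mod H)" "x <# H = Y <#> (g <# H) <#> inv\<^bsub>G Mod H\<^esub> Y"
    using cl gm by (auto simp: conj_class_def orbit_def conj_act_def)
  then obtain y where y: "y \<in> carrier G" "Y = H #> y"
    by (auto simp: FactGroup_def RCOSETS_def)
  have "inv\<^bsub>G Mod H\<^esub> Y = H #> inv y"
    using Y(1) y inv_FactGroup rcos_inv by metis
  then have "H #> x = H #> (y \<otimes> g \<otimes> inv y)"
    using Y(2) y g x coset_eq rcos_sum by simp
  then have "x \<in> H #> (y \<otimes> g \<otimes> inv y)" using x rcos_self subgroup_axioms by blast
  then obtain h where h: "h \<in> H" "x = h \<otimes> (y \<otimes> g \<otimes> inv y)" by (auto simp: r_coset_def)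
  have hc: "h \<in> carrier G" using h by simp
  have "inv y \<otimes> x \<otimes> inv (inv y) = (inv y \<otimes> h \<otimes> y) \<otimes> g"
    using h(2) hc y g by (simp add: m_assoc)
  moreover have "inv y \<otimes> h \<otimes> y \<in> H" using h y inv_op_closed1 by simp
  ultimately have "inv y \<otimes> x \<otimes> inv (inv y) \<in> g <# H"
    using g coset_eq by (auto simp: r_coset_def)
  then show thesis using that y by blast
qed

lemma orbit_subset_conj_class:
  assumes "x \<in> carrier G" "y \<in> carrier G"
  shows "orbit (G\<lparr>carrier := H\<rparr>) (conj_act G) (y \<otimes> x \<otimes> inv y) \<subseteq> conj_class G x"
proof
  fix z assume "z \<in> orbit (G\<lparr>carrier := H\<rparr>) (conj_act G) (y \<otimes> x \<otimes> inv y)"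
  then obtain n where n: "n \<in> H" "z = n \<otimes> (y \<otimes> x \<otimes> inv y) \<otimes> inv n"
    using assms orbit_conj_act by auto
  then have "z = (n \<otimes> y) \<otimes> x \<otimes> inv (n \<otimes> y)"
    using assms mem_carrier by (simp add: inv_mult_group m_assoc)
  moreover have "n \<otimes> y \<in> carrier G" using n assms by simp
  ultimately show "z \<in> conj_class G x"
    using assms by (auto simp: conj_class_def orbit_def conj_act_def)
qed

end

theorem lemmaA:
  fixes G :: "('a, 'b) monoid_scheme" (structure)
    and N :: "'a set"
    and g :: "nat \<Rightarrow> 'a"
  assumes "group G"
    and "finite (carrier G)"
    and "N \<lhd> G"
    and "\<And>i. i \<in> {1..class_number (G Mod N)} \<Longrightarrow> g i \<in> carrier G"
    and "bij_betw (\<lambda>i. conj_class (G Mod N) (g i <# N))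
           {1..class_number (G Mod N)} (conj_classes (G Mod N))"
  shows "class_number G \<le> (\<Sum>i = 1..class_number (G Mod N). card (fixed_classes G N (g i)))"
proof -
  interpret normal N G by fact
  let ?I = "{1..class_number (G Mod N)}"
  let ?A = "\<lambda>i. orbits (G\<lparr>carrier := N\<rparr>) (g i <# N) (conj_act G)"
  interpret A: group_action "G\<lparr>carrier := N\<rparr>" "carrier G" "conj_act G"
    by (rule conj_act_normal_subgroup)
  interpret C: group_action G "carrier G" "conj_act G"
    unfolding conj_act_def by (rule action_by_conjugation)
  interpret Q: group_action "G Mod N" "carrier (G Mod N)" "conj_act (G Mod N)"
    unfolding conj_act_def by (rule group.action_by_conjugation[OF factorgroup_is_group])
  have sub: "g i <# N \<subseteq> carrier G" if "i \<in> ?I" for i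
    using assms(4)[OF that] l_coset_subset_G subset by blast
  \<comment> \<open>Nonemptiness is recorded for the injectivity argument below: an orbit lying in
    two classes forces them to meet.\<close>
  have "\<exists>O' \<in> \<Union>(?A ` ?I). O' \<noteq> {} \<and> O' \<subseteq> K" if K: "K \<in> conj_classes G" for K
  proof -
    obtain x where x: "x \<in> carrier G" "K = conj_class G x"
      using K by (auto simp: conj_classes_def orbits_def conj_class_def)
    have xm: "x <# N \<in> carrier (G Mod N)"
      using x coset_eq by (auto simp: FactGroup_def RCOSETS_def)
    have "conj_class (G Mod N) (x <# N) \<in> conj_classes (G Mod N)"
      using xm by (auto simp: conj_classes_def orbits_def conj_class_def)
    then obtain i where i: "i \<in> ?I" "conj_class (G Mod N) (x <# N) = conj_class (G Mod N) (g i <# N)"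
      using bij_betw_imp_surj_on[OF assms(5)] by (metis (no_types, lifting) imageE)
    have gi: "g i \<in> carrier G" using assms(4) i by blast
    have "x <# N \<in> conj_class (G Mod N) (g i <# N)"
      using i(2) Q.orbit_refl[OF xm] by (simp add: conj_class_def)
    then obtain y where y: "y \<in> carrier G" "y \<otimes> x \<otimes> inv y \<in> g i <# N"
      using conjugate_in_coset[OF gi x(1)] by blast
    let ?O = "orbit (G\<lparr>carrier := N\<rparr>) (conj_act G) (y \<otimes> x \<otimes> inv y)"
    have "?O \<in> ?A i" using y by (auto simp: orbits_def)
    moreover have "?O \<noteq> {}" using A.orbit_refl[of "y \<otimes> x \<otimes> inv y"] x y by auto
    moreover have "?O \<subseteq> K" using orbit_subset_conj_class x y by simp
    ultimately show ?thesis using i(1) by blast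
  qed
  \<comment> \<open>Choosing one such orbit in every class of \<open>G\<close> embeds the classes
    into the orbits on the representative cosets.\<close>
  then obtain f where f: "\<And>K. K \<in> conj_classes G \<Longrightarrow> f K \<in> \<Union>(?A ` ?I) \<and> f K \<noteq> {} \<and> f K \<subseteq> K"
    by metis
  have "inj_on f (conj_classes G)"
  proof (rule inj_onI)
    fix K L assume K: "K \<in> conj_classes G" and L: "L \<in> conj_classes G" and "f K = f L"
    then have "K \<inter> L \<noteq> {}" using f[OF K] f[OF L] by auto
    then show "K = L" using C.disjoint_union K L by (auto simp: conj_classes_def)
  qed
  moreover have "f ` conj_classes G \<subseteq> \<Union>(?A ` ?I)" using f by blast
  moreover have finA: "finite (?A i)" if "i \<in> ?I" for i
    using finite_subset[OF sub[OF that] assms(2)] by (simp add: orbits_def)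
  ultimately have "class_number G \<le> card (\<Union>(?A ` ?I))"
    unfolding class_number_def[of G] by (intro card_inj_on_le) auto
  also have "\<dots> \<le> (\<Sum>i\<in>?I. card (?A i))" by (rule card_UN_le) simp
  also have "\<dots> = (\<Sum>i\<in>?I. card (fixed_classes G N (g i)))"
    using card_orbits_coset_eq_card_fixed_classes assms(2,4) by (intro sum.cong) auto
  finally show ?thesis .
qed

end
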